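(* Let $R$ be a ring and let $M_R\neq 0$ be a right $R$-module. Then the family $$\mathcal{F}=\{J \text{ an ideal of } R : \text{for every submodule } N_R\subseteq M,\ NJ=0 \implies N=0\}$$ satisfies $(P_1)$. Moreover, an ideal of $R$ that is maximal among the annihilators $\operatorname{ann}(N)=\{r\in R: Nr=0\}$ of nonzero submodules $N$ of $M$ is prime.
   Context: Rings are associative and unital, not necessarily commutative, and modules are unital; "ideal" means two-sided ideal. A family $\mathcal{F}$ of ideals of $R$ satisfies $(P_1)$ if $R\in\mathcal{F}$, $\mathcal{F}$ is closed under products ($I,J\in\mathcal{F}\Rightarrow IJ\in\mathcal{F}$), and $\mathcal{F}$ is upward closed ($I\in\mathcal{F}$ and $J\supseteq I$ an ideal imply $J\in\mathcal{F}$). *)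

theory Defs
  imports "HOL-Algebra.Algebra"
begin

(* The record of the left modules of HOL-Algebra also carries right modules: the field smult
   always takes the scalar first, so the right action x . r is stored as smult M r x. *)
abbreviation right_smult :: "'b \<Rightarrow> ('a, 'b, 'm) module_scheme \<Rightarrow> 'a \<Rightarrow> 'b"
  ("(_ \<triangleleft>\<^bsub>_\<^esub> _)" [71, 0, 71] 70)
  where "x \<triangleleft>\<^bsub>M\<^esub> r \<equiv> smult M r x"

(* The locale module of HOL-Algebra requires a commutative ring of scalars, hence a separate
   locale. Its locale submodule assumes nothing about the ring: it asks for an additive subgroup
   that is closed under the action, and so is also the notion of submodule of a right module. *)
locale right_module = R?: ring R + M?: abelian_group M
  for R :: "('a, 'r) ring_scheme" (structure) and M :: "('a, 'b, 'm) module_scheme" (structure) +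
  assumes right_smult_closed:
      "\<lbrakk>x \<in> carrier M; r \<in> carrier R\<rbrakk> \<Longrightarrow> x \<triangleleft>\<^bsub>M\<^esub> r \<in> carrier M"
    and right_smult_distr_scalar:
      "\<lbrakk>x \<in> carrier M; r \<in> carrier R; s \<in> carrier R\<rbrakk> \<Longrightarrow>
        x \<triangleleft>\<^bsub>M\<^esub> (r \<oplus>\<^bsub>R\<^esub> s) = (x \<triangleleft>\<^bsub>M\<^esub> r) \<oplus>\<^bsub>M\<^esub> (x \<triangleleft>\<^bsub>M\<^esub> s)"
    and right_smult_distr_vector:
      "\<lbrakk>x \<in> carrier M; y \<in> carrier M; r \<in> carrier R\<rbrakk> \<Longrightarrow>
        (x \<oplus>\<^bsub>M\<^esub> y) \<triangleleft>\<^bsub>M\<^esub> r = (x \<triangleleft>\<^bsub>M\<^esub> r) \<oplus>\<^bsub>M\<^esub> (y \<triangleleft>\<^bsub>M\<^esub> r)"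
    and right_smult_assoc:
      "\<lbrakk>x \<in> carrier M; r \<in> carrier R; s \<in> carrier R\<rbrakk> \<Longrightarrow>
        x \<triangleleft>\<^bsub>M\<^esub> (r \<otimes>\<^bsub>R\<^esub> s) = (x \<triangleleft>\<^bsub>M\<^esub> r) \<triangleleft>\<^bsub>M\<^esub> s"
    and right_smult_one:
      "x \<in> carrier M \<Longrightarrow> x \<triangleleft>\<^bsub>M\<^esub> \<one>\<^bsub>R\<^esub> = x"

(* N J is the additive subgroup of M generated by the products x . r. *)
definition right_module_prod :: "('a, 'b, 'm) module_scheme \<Rightarrow> 'b set \<Rightarrow> 'a set \<Rightarrow> 'b set"
  where "right_module_prod M N J =
    generate (add_monoid M) {x \<triangleleft>\<^bsub>M\<^esub> r | x r. x \<in> N \<and> r \<in> J}"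

definition right_ann ::
    "('a, 'r) ring_scheme \<Rightarrow> ('a, 'b, 'm) module_scheme \<Rightarrow> 'b set \<Rightarrow> 'a set"
  where "right_ann R M N = {r \<in> carrier R. \<forall>x\<in>N. x \<triangleleft>\<^bsub>M\<^esub> r = \<zero>\<^bsub>M\<^esub>}"

definition satisfies_P1 :: "('a, 'r) ring_scheme \<Rightarrow> 'a set set \<Rightarrow> bool"
  where "satisfies_P1 R \<F> \<longleftrightarrow>
    (\<forall>I\<in>\<F>. ideal I R) \<and>
    carrier R \<in> \<F> \<and>
    (\<forall>I\<in>\<F>. \<forall>J\<in>\<F>. I \<cdot>\<^bsub>R\<^esub> J \<in> \<F>) \<and>
    (\<forall>I\<in>\<F>. \<forall>J. ideal J R \<longrightarrow> I \<subseteq> J \<longrightarrow> J \<in> \<F>)"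

(* The locale primeideal of HOL-Algebra is elementwise and assumes commutativity; over a
   noncommutative ring primality is a condition on products of two-sided ideals. *)
definition nc_prime_ideal :: "'a set \<Rightarrow> ('a, 'r) ring_scheme \<Rightarrow> bool"
  where "nc_prime_ideal P R \<longleftrightarrow>
    ideal P R \<and> P \<noteq> carrier R \<and>
    (\<forall>I J. ideal I R \<longrightarrow> ideal J R \<longrightarrow> I \<cdot>\<^bsub>R\<^esub> J \<subseteq> P \<longrightarrow> I \<subseteq> P \<or> J \<subseteq> P)"

end

theory Submission
  imports Defs
begin

text \<open>
  For a submodule \<open>N\<close> and an ideal \<open>J\<close>, the elements of \<open>N\<close> killed by \<open>J\<close> form a submodule \<open>K\<close>,
  and \<open>N(IJ) = 0\<close> means \<open>NI \<subseteq> K\<close>. If \<open>K = 0\<close>, then \<open>NI = 0\<close>. This gives closure under products,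
  since \<open>KJ = 0\<close> forces \<open>K = 0\<close> for \<open>J\<close> in the family. It also gives primality of a maximal
  annihilator \<open>P = ann N\<close>: if \<open>IJ \<subseteq> P\<close>, either \<open>K = 0\<close> and \<open>I \<subseteq> P\<close>, or \<open>J \<subseteq> ann K = P\<close> by
  maximality.
\<close>

text \<open>The annihilator of \<open>J\<close> is taken inside \<open>N\<close> rather than in all
  of \<open>M\<close>, so that whatever kills \<open>N\<close> also kills this set; the maximality
  argument relies on that inclusion.\<close>

definition killed_by :: "('a, 'b, 'm) module_scheme \<Rightarrow> 'b set \<Rightarrow> 'a set \<Rightarrow> 'b set"
  where "killed_by M N J = {x \<in> N. \<forall>r\<in>J. x \<triangleleft>\<^bsub>M\<^esub> r = \<zero>\<^bsub>M\<^esub>}"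

context right_module
begin

text \<open>Viewing the action, in each variable separately, as a homomorphism of additive groups
  yields the four laws for zero and negatives from general group theory.\<close>

lemma right_smult_vector_group_hom:
  assumes "r \<in> carrier R"
  shows "group_hom (add_monoid M) (add_monoid M) (\<lambda>x. x \<triangleleft>\<^bsub>M\<^esub> r)"
  using assms M.a_group right_smult_closed right_smult_distr_vector
  by (auto intro!: group_hom.intro group_hom_axioms.intro homI)

lemma right_smult_scalar_group_hom:
  assumes "x \<in> carrier M"
  shows "group_hom (add_monoid R) (add_monoid M) (\<lambda>r. x \<triangleleft>\<^bsub>M\<^esub> r)"
  using assms R.a_group M.a_group right_smult_closed right_smult_distr_scalar
  by (auto intro!: group_hom.intro group_hom_axioms.intro homI)

lemma zero_right_smult: "r \<in> carrier R \<Longrightarrow> \<zero>\<^bsub>M\<^esub> \<triangleleft>\<^bsub>M\<^esub> r = \<zero>\<^bsub>M\<^esub>"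
  using group_hom.hom_one[OF right_smult_vector_group_hom] by simp

lemma minus_right_smult:
  "\<lbrakk>x \<in> carrier M; r \<in> carrier R\<rbrakk> \<Longrightarrow> (\<ominus>\<^bsub>M\<^esub> x) \<triangleleft>\<^bsub>M\<^esub> r = \<ominus>\<^bsub>M\<^esub> (x \<triangleleft>\<^bsub>M\<^esub> r)"
  using group_hom.hom_inv[OF right_smult_vector_group_hom] by (simp add: a_inv_def)

lemma right_smult_zero: "x \<in> carrier M \<Longrightarrow> x \<triangleleft>\<^bsub>M\<^esub> \<zero>\<^bsub>R\<^esub> = \<zero>\<^bsub>M\<^esub>"
  using group_hom.hom_one[OF right_smult_scalar_group_hom] by simp

lemma right_smult_minus:
  "\<lbrakk>x \<in> carrier M; r \<in> carrier R\<rbrakk> \<Longrightarrow> x \<triangleleft>\<^bsub>M\<^esub> (\<ominus>\<^bsub>R\<^esub> r) = \<ominus>\<^bsub>M\<^esub> (x \<triangleleft>\<^bsub>M\<^esub> r)"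
  using group_hom.hom_inv[OF right_smult_scalar_group_hom] by (simp add: a_inv_def)

lemma submodule_subset: "submodule N R M \<Longrightarrow> N \<subseteq> carrier M"
  using subgroup.subset[OF submodule.axioms(1)] by fastforce

lemma submodule_zero: "submodule N R M \<Longrightarrow> \<zero>\<^bsub>M\<^esub> \<in> N"
  using subgroup.one_closed[OF submodule.axioms(1)] by fastforce

text \<open>The trivial subgroup contains the generated one as soon as it contains the generators.
  Hence sums of products never have to be handled, and \<open>N\<close> and \<open>J\<close> may be
  arbitrary sets.\<close>

lemma right_module_prod_eq_zero_iff:
  "right_module_prod M N J = {\<zero>\<^bsub>M\<^esub>} \<longleftrightarrow> (\<forall>x\<in>N. \<forall>r\<in>J. x \<triangleleft>\<^bsub>M\<^esub> r = \<zero>\<^bsub>M\<^esub>)"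
proof
  assume "right_module_prod M N J = {\<zero>\<^bsub>M\<^esub>}"
  then show "\<forall>x\<in>N. \<forall>r\<in>J. x \<triangleleft>\<^bsub>M\<^esub> r = \<zero>\<^bsub>M\<^esub>"
    unfolding right_module_prod_def by (blast intro: generate.incl)
next
  assume *: "\<forall>x\<in>N. \<forall>r\<in>J. x \<triangleleft>\<^bsub>M\<^esub> r = \<zero>\<^bsub>M\<^esub>"
  have "right_module_prod M N J \<subseteq> {\<zero>\<^bsub>M\<^esub>}"
    unfolding right_module_prod_def
    by (rule M.add.generate_subgroup_incl[OF _ M.add.triv_subgroup]) (use * in auto)
  then show "right_module_prod M N J = {\<zero>\<^bsub>M\<^esub>}"
    \<comment> \<open>A generated subgroup always contains zero, even when there are no
      generators.\<close>
    unfolding right_module_prod_def using generate.one[of "add_monoid M"] by auto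
qed

lemma killed_by_submodule:
  assumes N: "submodule N R M" and J: "ideal J R"
  shows "submodule (killed_by M N J) R M"
proof -
  note subgroup_N = submodule.axioms(1)[OF N]
  have sub: "x \<in> carrier M" if "x \<in> N" for x
    using submodule_subset[OF N] that by blast
  have J_carr: "r \<in> carrier R" if "r \<in> J" for r
    using ideal.Icarr[OF J that] .
  show ?thesis
  proof (intro submodule.intro subgroup.intro submodule_axioms.intro)
    show "killed_by M N J \<subseteq> carrier (add_monoid M)"
      using sub by (auto simp: killed_by_def)
    show "\<one>\<^bsub>add_monoid M\<^esub> \<in> killed_by M N J"
      by (simp add: killed_by_def submodule_zero[OF N] zero_right_smult J_carr)
    show "x \<otimes>\<^bsub>add_monoid M\<^esub> y \<in> killed_by M N J"
      if "x \<in> killed_by M N J" "y \<in> killed_by M N J" for x y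
      using that subgroup.m_closed[OF subgroup_N, of x y]
      by (simp add: killed_by_def right_smult_distr_vector sub J_carr)
    show "inv\<^bsub>add_monoid M\<^esub> x \<in> killed_by M N J" if "x \<in> killed_by M N J" for x
      using that subgroup.m_inv_closed[OF subgroup_N, of x]
      by (simp add: killed_by_def minus_right_smult sub J_carr flip: a_inv_def)
    show "x \<triangleleft>\<^bsub>M\<^esub> r \<in> killed_by M N J" if r: "r \<in> carrier R" and x: "x \<in> killed_by M N J" for r x
    proof -
      have "x \<in> N" using x by (simp add: killed_by_def)
      \<comment> \<open>Associativity moves \<open>r\<close> over to \<open>s\<close>, and
        \<open>J\<close> absorbs it from the left, so \<open>x\<close> already kills the
        product.\<close>
      moreover have "(x \<triangleleft>\<^bsub>M\<^esub> r) \<triangleleft>\<^bsub>M\<^esub> s = \<zero>\<^bsub>M\<^esub>" if "s \<in> J" for s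
        using x ideal.I_l_closed[OF J that r] right_smult_assoc[OF sub r J_carr[OF that], of x]
        by (simp add: killed_by_def)
      ultimately show ?thesis
        using submodule.smult_closed[OF N r] by (simp add: killed_by_def)
    qed
  qed
qed

text \<open>For absorption on the left, \<open>s\<close> first moves \<open>x\<close> within the
  submodule \<open>N\<close>, where \<open>r\<close> kills it; on the right, \<open>s\<close> acts
  on an element that is already zero.\<close>

lemma right_ann_ideal:
  assumes N: "submodule N R M"
  shows "ideal (right_ann R M N) R"
proof (intro idealI R.ring_axioms subgroup.intro)
  have sub: "x \<in> carrier M" if "x \<in> N" for x
    using submodule_subset[OF N] that by blast
  show "right_ann R M N \<subseteq> carrier (add_monoid R)"
    by (auto simp: right_ann_def)
  show "\<one>\<^bsub>add_monoid R\<^esub> \<in> right_ann R M N"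
    by (simp add: right_ann_def right_smult_zero sub)
  show "r \<otimes>\<^bsub>add_monoid R\<^esub> s \<in> right_ann R M N"
    if "r \<in> right_ann R M N" "s \<in> right_ann R M N" for r s
    using that by (simp add: right_ann_def right_smult_distr_scalar sub)
  show "inv\<^bsub>add_monoid R\<^esub> r \<in> right_ann R M N" if "r \<in> right_ann R M N" for r
    using that by (simp add: right_ann_def right_smult_minus sub flip: a_inv_def)
  show "s \<otimes>\<^bsub>R\<^esub> r \<in> right_ann R M N" if "r \<in> right_ann R M N" "s \<in> carrier R" for r s
    using that submodule.smult_closed[OF N]
    by (simp add: right_ann_def right_smult_assoc sub)
  show "r \<otimes>\<^bsub>R\<^esub> s \<in> right_ann R M N" if "r \<in> right_ann R M N" "s \<in> carrier R" for r s
    using that by (simp add: right_ann_def right_smult_assoc zero_right_smult sub)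
qed

text \<open>The unit fixes every element, so it cannot annihilate a nonzero one. This puts the whole
  ring in the family and makes the prime ideal proper.\<close>

lemma right_ann_neq_carrier:
  assumes N: "submodule N R M" "N \<noteq> {\<zero>\<^bsub>M\<^esub>}"
  shows "right_ann R M N \<noteq> carrier R"
proof
  assume ann: "right_ann R M N = carrier R"
  obtain x where x: "x \<in> N" "x \<noteq> \<zero>\<^bsub>M\<^esub>"
    using N(2) submodule_zero[OF N(1)] by blast
  have "\<one>\<^bsub>R\<^esub> \<in> right_ann R M N"
    unfolding ann by (rule R.one_closed)
  then have "x \<triangleleft>\<^bsub>M\<^esub> \<one>\<^bsub>R\<^esub> = \<zero>\<^bsub>M\<^esub>"
    using x(1) by (simp add: right_ann_def)
  then show False
    using x submodule_subset[OF N(1)] right_smult_one[of x] by auto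
qed

text \<open>The step shared by both halves: by associativity, \<open>j\<close> sends
  \<open>x\<close> acted on by \<open>i\<close> to \<open>x\<close> acted on by a product from the
  ideal product, which is zero. Only elementary products are needed.\<close>

lemma right_smult_mem_killed_by:
  assumes "submodule N R M" "ideal I R" "ideal J R" "I \<cdot>\<^bsub>R\<^esub> J \<subseteq> right_ann R M N"
    and "x \<in> N" "i \<in> I"
  shows "x \<triangleleft>\<^bsub>M\<^esub> i \<in> killed_by M N J"
proof -
  have x: "x \<in> carrier M" and i: "i \<in> carrier R"
    using submodule_subset[OF assms(1)] assms(5) ideal.Icarr[OF assms(2,6)] by auto
  have "(x \<triangleleft>\<^bsub>M\<^esub> i) \<triangleleft>\<^bsub>M\<^esub> j = \<zero>\<^bsub>M\<^esub>" if "j \<in> J" for j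
  proof -
    have "i \<otimes>\<^bsub>R\<^esub> j \<in> right_ann R M N"
      using assms(4) ideal_prod.prod[OF assms(6) that] by (rule subsetD)
    then have "x \<triangleleft>\<^bsub>M\<^esub> (i \<otimes>\<^bsub>R\<^esub> j) = \<zero>\<^bsub>M\<^esub>"
      using assms(5) by (simp add: right_ann_def)
    then show ?thesis
      using right_smult_assoc[OF x i] ideal.Icarr[OF assms(3) that] by simp
  qed
  then show ?thesis
    using submodule.smult_closed[OF assms(1) i assms(5)] by (simp add: killed_by_def)
qed

lemma satisfies_P1_ideals_killing_no_submodule:
  "satisfies_P1 R
      {J. ideal J R \<and>
        (\<forall>N. submodule N R M \<longrightarrow> right_module_prod M N J = {\<zero>\<^bsub>M\<^esub>} \<longrightarrow> N = {\<zero>\<^bsub>M\<^esub>})}"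
    (is "satisfies_P1 R ?F")
proof -
  have "carrier R \<in> ?F"
  proof (intro CollectI conjI allI impI R.oneideal)
    fix N
    assume N: "submodule N R M" and "right_module_prod M N (carrier R) = {\<zero>\<^bsub>M\<^esub>}"
    then have "right_ann R M N = carrier R"
      unfolding right_module_prod_eq_zero_iff right_ann_def by blast
    then show "N = {\<zero>\<^bsub>M\<^esub>}"
      using right_ann_neq_carrier[OF N] by blast
  qed
  moreover have "I \<cdot>\<^bsub>R\<^esub> J \<in> ?F" if "I \<in> ?F" "J \<in> ?F" for I J
  proof -
    have I: "ideal I R" and J: "ideal J R" using that by auto
    have "N = {\<zero>\<^bsub>M\<^esub>}"
      if N: "submodule N R M" and NIJ: "right_module_prod M N (I \<cdot>\<^bsub>R\<^esub> J) = {\<zero>\<^bsub>M\<^esub>}" for N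
    proof -
      have "I \<cdot>\<^bsub>R\<^esub> J \<subseteq> right_ann R M N"
        using NIJ R.ideal_prod_in_carrier[OF I J]
        by (auto simp: right_module_prod_eq_zero_iff right_ann_def)
      note mem = right_smult_mem_killed_by[OF N I J this]
      have "right_module_prod M (killed_by M N J) J = {\<zero>\<^bsub>M\<^esub>}"
        by (simp add: right_module_prod_eq_zero_iff killed_by_def)
      \<comment> \<open>By construction \<open>J\<close> annihilates this submodule, so membership
        of \<open>J\<close> in the family makes it zero.\<close>
      then have "killed_by M N J = {\<zero>\<^bsub>M\<^esub>}"
        using \<open>J \<in> ?F\<close> killed_by_submodule[OF N J] by blast
      \<comment> \<open>By \<open>mem\<close>, every generator of \<open>N I\<close> lies in the
        submodule just shown to be zero.\<close>
      then have "right_module_prod M N I = {\<zero>\<^bsub>M\<^esub>}"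
        using mem by (simp add: right_module_prod_eq_zero_iff)
      then show ?thesis using \<open>I \<in> ?F\<close> N by blast
    qed
    then show ?thesis using R.ideal_prod_is_ideal[OF I J] by blast
  qed
  moreover have "J \<in> ?F" if "I \<in> ?F" "ideal J R" "I \<subseteq> J" for I J
    \<comment> \<open>A submodule killed by the larger ideal is killed by the smaller one.\<close>
    using that unfolding right_module_prod_eq_zero_iff mem_Collect_eq
    by (meson subsetD)
  ultimately show ?thesis
    unfolding satisfies_P1_def by blast
qed

lemma maximal_right_ann_nc_prime:
  assumes N: "submodule N R M" "N \<noteq> {\<zero>\<^bsub>M\<^esub>}"
    and max: "\<And>K. \<lbrakk>submodule K R M; K \<noteq> {\<zero>\<^bsub>M\<^esub>}; right_ann R M N \<subseteq> right_ann R M K\<rbrakk>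
      \<Longrightarrow> right_ann R M K = right_ann R M N"
  shows "nc_prime_ideal (right_ann R M N) R"
proof -
  have "I \<subseteq> right_ann R M N \<or> J \<subseteq> right_ann R M N"
    if I: "ideal I R" and J: "ideal J R" and IJ: "I \<cdot>\<^bsub>R\<^esub> J \<subseteq> right_ann R M N" for I J
  proof (cases "killed_by M N J = {\<zero>\<^bsub>M\<^esub>}")
    case True
    \<comment> \<open>Elements of \<open>N\<close> acted on by \<open>I\<close> land in
      \<open>killed_by M N J\<close>, here zero, so \<open>I\<close> annihilates
      \<open>N\<close>.\<close>
    then have "I \<subseteq> right_ann R M N"
      using right_smult_mem_killed_by[OF N(1) I J IJ] ideal.Icarr[OF I]
      by (auto simp: right_ann_def)
    then show ?thesis ..
  next
    case False
    \<comment> \<open>Annihilators reverse inclusions; as the smaller submodule is nonzero,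
      maximality turns this into an equality.\<close>
    have "right_ann R M N \<subseteq> right_ann R M (killed_by M N J)"
      by (auto simp: right_ann_def killed_by_def)
    then have "right_ann R M (killed_by M N J) = right_ann R M N"
      using max killed_by_submodule[OF N(1) J] False by blast
    moreover have "J \<subseteq> right_ann R M (killed_by M N J)"
      using ideal.Icarr[OF J] by (auto simp: right_ann_def killed_by_def)
    ultimately show ?thesis by simp
  qed
  then show ?thesis
    unfolding nc_prime_ideal_def
    using right_ann_ideal[OF N(1)] right_ann_neq_carrier[OF N] by blast
qed

end

theorem proposition3p5:
  fixes R :: "('a, 'r) ring_scheme" and M :: "('a, 'b, 'm) module_scheme"
  assumes "right_module R M"
    and "carrier M \<noteq> {\<zero>\<^bsub>M\<^esub>}"
  shows "satisfies_P1 R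
      {J. ideal J R \<and>
        (\<forall>N. submodule N R M \<longrightarrow> right_module_prod M N J = {\<zero>\<^bsub>M\<^esub>} \<longrightarrow> N = {\<zero>\<^bsub>M\<^esub>})} \<and>
    (\<forall>P \<in> {right_ann R M N | N. submodule N R M \<and> N \<noteq> {\<zero>\<^bsub>M\<^esub>}}.
      (\<forall>Q \<in> {right_ann R M N | N. submodule N R M \<and> N \<noteq> {\<zero>\<^bsub>M\<^esub>}}. P \<subseteq> Q \<longrightarrow> Q = P) \<longrightarrow>
      nc_prime_ideal P R)"
proof (intro conjI ballI impI)
  interpret right_module R M by (rule assms(1))
  show "satisfies_P1 R
      {J. ideal J R \<and>
        (\<forall>N. submodule N R M \<longrightarrow> right_module_prod M N J = {\<zero>\<^bsub>M\<^esub>} \<longrightarrow> N = {\<zero>\<^bsub>M\<^esub>})}"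
    by (rule satisfies_P1_ideals_killing_no_submodule)
  fix P
  let ?A = "{right_ann R M N | N. submodule N R M \<and> N \<noteq> {\<zero>\<^bsub>M\<^esub>}}"
  assume "P \<in> ?A" and max: "\<forall>Q\<in>?A. P \<subseteq> Q \<longrightarrow> Q = P"
  then obtain N where N: "submodule N R M" "N \<noteq> {\<zero>\<^bsub>M\<^esub>}" and P: "P = right_ann R M N"
    by blast
  show "nc_prime_ideal P R"
    \<comment> \<open>Maximality among the members of \<open>?A\<close> is applied to the
      annihilator of each competing submodule.\<close>
    unfolding P using max P by (intro maximal_right_ann_nc_prime[OF N]) blast
qed

end
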